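(* Let $M=(E,\mathcal I)$ be a matroid with weights $\sigma\in\mathbb R^E_{>0}$. Let $\eta^*$ be the universal density of $M$ with weights $\sigma$, and let $E_{\max}$ be the set of elements $e\in E$ at which $\sigma(e)^{-1}\eta^*(e)$ attains its maximal value. Let $H$ be a subset of $E$. If $H\cap E_{\max}\ne\emptyset$, then $S_\sigma(M|H)\le S_\sigma(M)$.
   Context: The matroid $M$ is finite, loopless and of positive rank. The universal density of $M$ with weights $\sigma$ is the unique minimizer of $\sum_{e\in E}\sigma(e)^{-1}\eta(e)^2$ over the convex hull in $\mathbb R^E$ of the indicator vectors of the bases of $M$. For a matroid of positive rank with ground set $E$, rank function $r$ and weights $\sigma$, $$S_\sigma(M)=\min\Big\{\tfrac{\sigma(X)}{r(E)-r(E-X)}:X\subseteq E,\ r(E)>r(E-X)\Big\},\qquad \sigma(X)=\sum_{e\in X}\sigma(e).$$ $M|H$ is the restriction of $M$ to $H$, with the restricted weights. *)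

theory Defs
  imports "HOL-Analysis.Analysis" "HOL-Library.Function_Algebras"
begin

section \<open>Real-valued functions as a real vector space\<close>

text \<open>
  With the pointwise operations on functions, \<open>\<real>\<^sup>E\<close> is represented by \<^typ>\<open>'a \<Rightarrow> real\<close>, where
  \<open>E\<close> is a set of elements of \<^typ>\<open>'a\<close>, and the library's \<^const>\<open>convex\<close> \<^const>\<open>hull\<close> is
  available. Vectors in the base polytope below vanish outside \<open>E\<close>; the values of a weight
  function outside \<open>E\<close> are irrelevant.
\<close>

instantiation "fun" :: (type, real_vector) real_vector
begin

definition scaleR_fun :: "real \<Rightarrow> ('a \<Rightarrow> 'b) \<Rightarrow> 'a \<Rightarrow> 'b" where
  "scaleR_fun c f = (\<lambda>x. c *\<^sub>R f x)"

instance
  by standard (simp_all add: scaleR_fun_def fun_eq_iff algebra_simps)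

end

lemma scaleR_fun_apply [simp]: "(c *\<^sub>R f) x = c *\<^sub>R f x"
  by (simp add: scaleR_fun_def)

lemma sum_fun_apply: "(\<Sum>i\<in>A. f i) x = (\<Sum>i\<in>A. f i x)"
  for f :: "'i \<Rightarrow> 'a \<Rightarrow> 'b::comm_monoid_add"
  by (induction A rule: infinite_finite_induct) simp_all


section \<open>Matroids\<close>

locale matroid =
  fixes E :: "'a set" and \<I> :: "'a set set"
  assumes finite_ground: "finite E"
    and indep_subset_ground: "J \<in> \<I> \<Longrightarrow> J \<subseteq> E"
    and indep_empty: "{} \<in> \<I>"
    and indep_hereditary: "J \<in> \<I> \<Longrightarrow> K \<subseteq> J \<Longrightarrow> K \<in> \<I>"
    and augmentation: "J \<in> \<I> \<Longrightarrow> K \<in> \<I> \<Longrightarrow> card J < card K \<Longrightarrow> \<exists>x\<in>K - J. insert x J \<in> \<I>"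

definition loopless :: "'a set \<Rightarrow> 'a set set \<Rightarrow> bool" where
  "loopless E \<I> \<longleftrightarrow> (\<forall>e\<in>E. {e} \<in> \<I>)"

definition matroid_rank :: "'a set set \<Rightarrow> 'a set \<Rightarrow> nat" where
  "matroid_rank \<I> X = Max {card J | J. J \<in> \<I> \<and> J \<subseteq> X}"

definition bases :: "'a set set \<Rightarrow> 'a set set" where
  "bases \<I> = {B \<in> \<I>. \<forall>J\<in>\<I>. B \<subseteq> J \<longrightarrow> J = B}"

text \<open>The independent sets of the restriction \<open>M|H\<close>, whose ground set is \<open>H\<close>.\<close>

definition restrict_indep :: "'a set set \<Rightarrow> 'a set \<Rightarrow> 'a set set" where
  "restrict_indep \<I> H = {J \<in> \<I>. J \<subseteq> H}"

lemma matroid_restrict: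
  assumes "matroid E \<I>" "H \<subseteq> E"
  shows "matroid H (restrict_indep \<I> H)"
proof -
  interpret matroid E \<I> by fact
  show ?thesis
  proof
    show "finite H" using finite_subset[OF assms(2) finite_ground] .
    show "{} \<in> restrict_indep \<I> H" using indep_empty by (simp add: restrict_indep_def)
  next
    fix J assume "J \<in> restrict_indep \<I> H"
    then show "J \<subseteq> H" by (simp add: restrict_indep_def)
  next
    fix J K assume "J \<in> restrict_indep \<I> H" "K \<subseteq> J"
    then show "K \<in> restrict_indep \<I> H"
      using indep_hereditary[of J K] by (auto simp: restrict_indep_def)
  next
    fix J K assume JK: "J \<in> restrict_indep \<I> H" "K \<in> restrict_indep \<I> H" "card J < card K"
    then obtain x where "x \<in> K - J" "insert x J \<in> \<I>"
      using augmentation[of J K] by (auto simp: restrict_indep_def)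
    with JK show "\<exists>x\<in>K - J. insert x J \<in> restrict_indep \<I> H"
      by (intro bexI[of _ x]) (auto simp: restrict_indep_def)
  qed
qed


section \<open>Strength\<close>

text \<open>
  The \<^const>\<open>Min\<close> is over a finite set, which is nonempty when the rank is positive (take
  \<open>X = E\<close>). The differences of ranks are formed in \<^typ>\<open>real\<close>.
\<close>

definition strength :: "'a set \<Rightarrow> 'a set set \<Rightarrow> ('a \<Rightarrow> real) \<Rightarrow> real" where
  "strength E \<I> \<sigma> =
     Min {(\<Sum>e\<in>X. \<sigma> e) / (real (matroid_rank \<I> E) - real (matroid_rank \<I> (E - X))) | X.
            X \<subseteq> E \<and> matroid_rank \<I> E > matroid_rank \<I> (E - X)}"


section \<open>Universal density\<close>

definition base_polytope :: "'a set set \<Rightarrow> ('a \<Rightarrow> real) set" where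
  "base_polytope \<I> = convex hull ((\<lambda>B. indicator B) ` bases \<I>)"

definition density_energy :: "'a set \<Rightarrow> ('a \<Rightarrow> real) \<Rightarrow> ('a \<Rightarrow> real) \<Rightarrow> real" where
  "density_energy E \<sigma> \<eta> = (\<Sum>e\<in>E. inverse (\<sigma> e) * (\<eta> e)\<^sup>2)"

definition universal_density :: "'a set \<Rightarrow> 'a set set \<Rightarrow> ('a \<Rightarrow> real) \<Rightarrow> 'a \<Rightarrow> real" where
  "universal_density E \<I> \<sigma> =
     (THE \<eta>. is_arg_min (density_energy E \<sigma>) (\<lambda>\<eta>. \<eta> \<in> base_polytope \<I>) \<eta>)"

definition E_max :: "'a set \<Rightarrow> 'a set set \<Rightarrow> ('a \<Rightarrow> real) \<Rightarrow> 'a set" where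
  "E_max E \<I> \<sigma> =
     {e \<in> E. \<forall>f\<in>E. inverse (\<sigma> f) * universal_density E \<I> \<sigma> f
                  \<le> inverse (\<sigma> e) * universal_density E \<I> \<sigma> e}"


subsection \<open>The universal density is well defined\<close>

context matroid
begin

lemma finite_indep: "finite \<I>"
  using indep_subset_ground finite_ground by (intro finite_subset[of \<I> "Pow E"]) auto

lemma finite_bases: "finite (bases \<I>)"
  using finite_indep by (auto simp: bases_def)

lemma bases_nonempty: "bases \<I> \<noteq> {}"
proof -
  obtain B where "B \<in> \<I>" "\<forall>J\<in>\<I>. B \<subseteq> J \<longrightarrow> B = J"
    using finite_has_maximal[OF finite_indep] indep_empty by (metis empty_iff)
  then have "B \<in> bases \<I>" by (auto simp: bases_def)
  then show ?thesis by blast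
qed

lemma base_polytope_vanishes_outside:
  assumes "\<eta> \<in> base_polytope \<I>" "e \<notin> E"
  shows "\<eta> e = 0"
proof -
  have "convex {\<eta> :: 'a \<Rightarrow> real. \<eta> e = 0}"
    by (auto simp: convex_def)
  moreover have "(\<lambda>B. indicator B) ` bases \<I> \<subseteq> {\<eta> :: 'a \<Rightarrow> real. \<eta> e = 0}"
  proof
    fix \<eta> :: "'a \<Rightarrow> real" assume "\<eta> \<in> (\<lambda>B. indicator B) ` bases \<I>"
    then obtain B where "B \<in> \<I>" "\<eta> = indicator B" by (auto simp: bases_def)
    then show "\<eta> \<in> {\<eta>. \<eta> e = 0}" using assms(2) indep_subset_ground[of B] by (auto simp: indicator_def)
  qed
  ultimately have "base_polytope \<I> \<subseteq> {\<eta>. \<eta> e = 0}"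
    unfolding base_polytope_def by (simp add: subset_hull)
  then show ?thesis using assms(1) by auto
qed

lemma ex_minimizer:
  "\<exists>\<eta>. is_arg_min (density_energy E \<sigma>) (\<lambda>\<eta>. \<eta> \<in> base_polytope \<I>) \<eta>"
proof -
  define S where "S = (\<lambda>B. indicator B :: 'a \<Rightarrow> real) ` bases \<I>"
  have S: "finite S" "S \<noteq> {}" using finite_bases bases_nonempty by (auto simp: S_def)
  define K where "K = (PiE UNIV (\<lambda>_. {0..1::real})) \<inter> {u :: ('a \<Rightarrow> real) \<Rightarrow> real. (\<Sum>v\<in>S. u v) = 1}"
  define F where "F u = (\<Sum>v\<in>S. u v *\<^sub>R v)" for u :: "('a \<Rightarrow> real) \<Rightarrow> real"
  have "compact (PiE UNIV (\<lambda>_::'a \<Rightarrow> real. {0..1::real}))"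
    using compactin_PiE[of "\<lambda>_::'a \<Rightarrow> real. euclidean :: real topology" UNIV "\<lambda>_. {0..1}"]
    by (simp add: euclidean_product_topology)
  moreover have "closed {u :: ('a \<Rightarrow> real) \<Rightarrow> real. (\<Sum>v\<in>S. u v) = 1}"
    by (intro closed_Collect_eq continuous_intros continuous_on_product_coordinates)
  ultimately have K: "compact K" unfolding K_def by (rule compact_Int_closed)
  obtain v0 where "v0 \<in> S" using S by auto
  then have "(\<lambda>v. if v = v0 then 1 else 0) \<in> K"
    using S by (simp add: K_def PiE_iff)
  then have "K \<noteq> {}" by auto
  moreover have "continuous_on K (\<lambda>u. density_energy E \<sigma> (F u))"
    unfolding density_energy_def F_def sum_fun_apply scaleR_fun_apply
    by (intro continuous_intros continuous_on_subset[OF continuous_on_product_coordinates]) auto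
  ultimately obtain u where u: "u \<in> K"
    "\<And>w. w \<in> K \<Longrightarrow> density_energy E \<sigma> (F u) \<le> density_energy E \<sigma> (F w)"
    using continuous_attains_inf[OF K] by blast
  have hull: "base_polytope \<I> = F ` K"
  proof (intro equalityI subsetI)
    fix \<eta> assume "\<eta> \<in> base_polytope \<I>"
    then obtain w where w: "\<forall>x\<in>S. 0 \<le> w x" "sum w S = 1" "(\<Sum>x\<in>S. w x *\<^sub>R x) = \<eta>"
      unfolding base_polytope_def S_def[symmetric] convex_hull_finite[OF S(1)] by auto
    define w' where "w' x = (if x \<in> S then w x else 0)" for x
    have "w x \<le> 1" if "x \<in> S" for x
      using member_le_sum[of x S w] w S that by auto
    then have "w' \<in> K" using w by (auto simp: K_def w'_def)
    moreover have "F w' = \<eta>" using w(3) by (simp add: F_def w'_def)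
    ultimately show "\<eta> \<in> F ` K" by blast
  next
    fix \<eta> assume "\<eta> \<in> F ` K"
    then obtain w where "w \<in> K" "\<eta> = F w" by auto
    then show "\<eta> \<in> base_polytope \<I>"
      unfolding base_polytope_def S_def[symmetric] convex_hull_finite[OF S(1)] mem_Collect_eq
      by (intro exI[of _ w]) (auto simp: K_def F_def PiE_iff)
  qed
  have "is_arg_min (density_energy E \<sigma>) (\<lambda>\<eta>. \<eta> \<in> base_polytope \<I>) (F u)"
    unfolding is_arg_min_def hull not_ex de_Morgan_conj not_less
  proof (intro conjI allI)
    show "F u \<in> F ` K" using u(1) by (rule imageI)
    show "\<eta> \<notin> F ` K \<or> density_energy E \<sigma> (F u) \<le> density_energy E \<sigma> \<eta>" for \<eta>
      using u(2) by blast
  qed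
  then show ?thesis by (rule exI[where x = "F u"])
qed

lemma minimizer_unique:
  assumes \<sigma>: "\<And>e. e \<in> E \<Longrightarrow> \<sigma> e > 0"
    and \<eta>: "is_arg_min (density_energy E \<sigma>) (\<lambda>\<eta>. \<eta> \<in> base_polytope \<I>) \<eta>"
    and \<theta>: "is_arg_min (density_energy E \<sigma>) (\<lambda>\<eta>. \<eta> \<in> base_polytope \<I>) \<theta>"
  shows "\<eta> = \<theta>"
proof (rule ext)
  fix e
  let ?f = "density_energy E \<sigma>"
  define \<mu> where "\<mu> = (1/2) *\<^sub>R \<eta> + (1/2) *\<^sub>R \<theta>"
  have mem: "\<eta> \<in> base_polytope \<I>" "\<theta> \<in> base_polytope \<I>"
    using \<eta> \<theta> by (auto simp: is_arg_min_def)
  then have "\<mu> \<in> base_polytope \<I>"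
    unfolding \<mu>_def base_polytope_def by (intro convexD[OF convex_convex_hull]) auto
  then have le: "?f \<eta> \<le> ?f \<mu>" "?f \<eta> = ?f \<theta>"
    using \<eta> \<theta> mem by (auto simp: is_arg_min_def not_less intro: antisym)
  have "t * (1/2 * x + 1/2 * y)\<^sup>2 + t * ((x - y)/2)\<^sup>2 = (t * x\<^sup>2 + t * y\<^sup>2) / 2" for t x y :: real
    by (simp add: power2_eq_square field_simps)
  then have "inverse (\<sigma> e) * (\<mu> e)\<^sup>2 + inverse (\<sigma> e) * ((\<eta> e - \<theta> e)/2)\<^sup>2
      = (inverse (\<sigma> e) * (\<eta> e)\<^sup>2 + inverse (\<sigma> e) * (\<theta> e)\<^sup>2) / 2" for e
    unfolding \<mu>_def plus_fun_apply scaleR_fun_apply real_scaleR_def .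
  then have "?f \<mu> + (\<Sum>e\<in>E. inverse (\<sigma> e) * ((\<eta> e - \<theta> e)/2)\<^sup>2) = (?f \<eta> + ?f \<theta>) / 2"
    unfolding density_energy_def sum.distrib[symmetric] sum_divide_distrib by (intro sum.cong refl)
  with le have le0: "(\<Sum>e\<in>E. inverse (\<sigma> e) * ((\<eta> e - \<theta> e)/2)\<^sup>2) \<le> 0" by simp
  have ge0: "inverse (\<sigma> e) * ((\<eta> e - \<theta> e)/2)\<^sup>2 \<ge> 0" if "e \<in> E" for e
    using \<sigma>[OF that] by (intro mult_nonneg_nonneg) auto
  have "(\<Sum>e\<in>E. inverse (\<sigma> e) * ((\<eta> e - \<theta> e)/2)\<^sup>2) = 0"
    using le0 sum_nonneg[of E "\<lambda>e. inverse (\<sigma> e) * ((\<eta> e - \<theta> e)/2)\<^sup>2"] ge0 by fastforce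
  then have "\<forall>e\<in>E. inverse (\<sigma> e) * ((\<eta> e - \<theta> e)/2)\<^sup>2 = 0"
    using sum_nonneg_eq_0_iff[of E "\<lambda>e. inverse (\<sigma> e) * ((\<eta> e - \<theta> e)/2)\<^sup>2"]
      finite_ground ge0 by blast
  then have "\<eta> e = \<theta> e" if "e \<in> E"
    using that \<sigma>[OF that] by fastforce
  then show "\<eta> e = \<theta> e"
    using base_polytope_vanishes_outside[OF mem(1), of e]
      base_polytope_vanishes_outside[OF mem(2), of e] by (cases "e \<in> E") auto
qed

lemma universal_density_is_arg_min:
  assumes "\<And>e. e \<in> E \<Longrightarrow> \<sigma> e > 0"
  shows "is_arg_min (density_energy E \<sigma>) (\<lambda>\<eta>. \<eta> \<in> base_polytope \<I>) (universal_density E \<I> \<sigma>)"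
proof -
  define P where "P = is_arg_min (density_energy E \<sigma>) (\<lambda>\<eta>. \<eta> \<in> base_polytope \<I>)"
  obtain \<eta> where "P \<eta>" using ex_minimizer[of \<sigma>] unfolding P_def by (rule exE)
  moreover have "\<theta> = \<eta>'" if "P \<theta>" "P \<eta>'" for \<theta> \<eta>'
    using assms that unfolding P_def by (rule minimizer_unique)
  ultimately have "\<exists>!\<eta>. P \<eta>" by blast
  then have "P (THE \<eta>. P \<eta>)" by (rule theI')
  then show ?thesis unfolding P_def universal_density_def .
qed

end

end

theory Submission
  imports Defs
begin

text \<open>
  Let \<open>\<eta>\<close> be the universal density, \<open>\<rho> = \<eta> / \<sigma>\<close>, and let \<open>m\<close> be the maximum of \<open>\<rho>\<close>, which is
  positive because \<open>\<eta>(E) = r(E) > 0\<close>. The number \<open>1 / m\<close> separates the two strengths.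

  Since \<open>\<eta>\<close> is a convex combination of bases, \<open>\<eta>(X) \<ge> r(E) - r(E - X)\<close> for all \<open>X\<close>, and
  \<open>\<eta> \<le> m \<sigma>\<close> turns this into \<open>1 / m \<le> S\<^sub>\<sigma>(M)\<close>.

  For the other side, the first-order condition at the minimizer \<open>\<eta>\<close> of the energy says that
  every base that occurs in \<open>\<eta>\<close> has minimum weight with respect to \<open>\<rho>\<close>. Let \<open>F = E - E\<^sub>m\<^sub>a\<^sub>x\<close>.
  A base of minimum \<open>\<rho>\<close>-weight must span \<open>F\<close>: otherwise an element of \<open>E\<^sub>m\<^sub>a\<^sub>x\<close> could be
  exchanged for an element of \<open>F\<close>, which is strictly cheaper. Hence \<open>\<eta>(F) = r(F)\<close>
  (lemma \<open>universal_density_tight\<close>). Now take \<open>X = H \<inter> E\<^sub>m\<^sub>a\<^sub>x\<close>, so that \<open>H - X = H \<inter> F\<close>.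
  Submodularity of the rank gives
  \<open>m \<sigma>(X) = \<eta>(X) = \<eta>(H \<union> F) - \<eta>(F) \<le> r(H \<union> F) - r(F) \<le> r(H) - r(H - X)\<close>.
  The left side is positive as soon as \<open>X\<close> is nonempty, so \<open>X\<close> is admissible in the definition of
  the strength of \<open>M|H\<close> and witnesses \<open>S\<^sub>\<sigma>(M|H) \<le> 1 / m\<close>.
\<close>

section \<open>Rank and bases of a matroid\<close>

context matroid
begin

lemma finite_indep_set: "J \<in> \<I> \<Longrightarrow> finite J"
  by (rule finite_subset[OF indep_subset_ground finite_ground])

lemma finite_indep_cards: "finite {card J | J. J \<in> \<I> \<and> J \<subseteq> X}"
  using finite_indep by simp

lemma card_le_rank: "J \<in> \<I> \<Longrightarrow> J \<subseteq> X \<Longrightarrow> card J \<le> matroid_rank \<I> X"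
  unfolding matroid_rank_def by (rule Max_ge[OF finite_indep_cards]) auto

lemma rank_attained:
  obtains J where "J \<in> \<I>" "J \<subseteq> X" "card J = matroid_rank \<I> X"
proof -
  have "matroid_rank \<I> X \<in> {card J | J. J \<in> \<I> \<and> J \<subseteq> X}"
    unfolding matroid_rank_def using indep_empty by (intro Max_in[OF finite_indep_cards]) auto
  then show ?thesis using that by auto
qed

lemma indep_extends_to_rank:
  assumes "J \<in> \<I>" "J \<subseteq> X"
  obtains K where "K \<in> \<I>" "J \<subseteq> K" "K \<subseteq> X" "card K = matroid_rank \<I> X"
proof -
  have "finite {K \<in> \<I>. K \<subseteq> X}" using finite_indep by simp
  moreover have "J \<in> {K \<in> \<I>. K \<subseteq> X}" using assms by simp
  ultimately obtain K where K: "K \<in> \<I>" "K \<subseteq> X" "J \<subseteq> K"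
    and max: "\<And>L. L \<in> \<I> \<Longrightarrow> L \<subseteq> X \<Longrightarrow> K \<subseteq> L \<Longrightarrow> K = L"
    using finite_has_maximal2[of "{K \<in> \<I>. K \<subseteq> X}" J] by auto
  obtain L where L: "L \<in> \<I>" "L \<subseteq> X" "card L = matroid_rank \<I> X" by (rule rank_attained)
  have "\<not> card K < card L"
  proof
    assume "card K < card L"
    then obtain x where "x \<in> L - K" "insert x K \<in> \<I>"
      using augmentation[OF K(1) L(1)] by blast
    then show False using max[of "insert x K"] K L by auto
  qed
  then have "card K = matroid_rank \<I> X" using card_le_rank[OF K(1,2)] L(3) by simp
  with K(1,3,2) show ?thesis by (rule that)
qed

text \<open>
  An independent set that spans \<open>X \<inter> Y\<close> extends to one that spans \<open>X \<union> Y\<close>; the traces of the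
  latter on \<open>X\<close> and on \<open>Y\<close> are independent, and inclusion-exclusion counts them.
\<close>

lemma rank_submodular:
  "matroid_rank \<I> (X \<union> Y) + matroid_rank \<I> (X \<inter> Y) \<le> matroid_rank \<I> X + matroid_rank \<I> Y"
proof -
  obtain J where J: "J \<in> \<I>" "J \<subseteq> X \<inter> Y" "card J = matroid_rank \<I> (X \<inter> Y)"
    by (rule rank_attained)
  have "J \<subseteq> X \<union> Y" using J(2) by blast
  with J(1) obtain K where K: "K \<in> \<I>" "J \<subseteq> K" "K \<subseteq> X \<union> Y" "card K = matroid_rank \<I> (X \<union> Y)"
    by (rule indep_extends_to_rank)
  have "finite K" using finite_indep_set[OF K(1)] .
  have "card J \<le> card (K \<inter> X \<inter> (K \<inter> Y))"
    using J(2) K(2) \<open>finite K\<close> by (intro card_mono) auto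
  moreover have "K \<inter> X \<union> K \<inter> Y = K" using K(3) by blast
  ultimately have "card K + card J \<le> card (K \<inter> X) + card (K \<inter> Y)"
    using card_Un_Int[of "K \<inter> X" "K \<inter> Y"] \<open>finite K\<close> by simp
  also have "\<dots> \<le> matroid_rank \<I> X + matroid_rank \<I> Y"
    using indep_hereditary[OF K(1)] by (intro add_mono card_le_rank) auto
  finally show ?thesis using J K by simp
qed

lemma base_iff_card_eq_rank: "B \<in> bases \<I> \<longleftrightarrow> B \<in> \<I> \<and> card B = matroid_rank \<I> E"
proof
  assume B: "B \<in> bases \<I>"
  then have BI: "B \<in> \<I>" by (simp add: bases_def)
  obtain K where K: "K \<in> \<I>" "B \<subseteq> K" "K \<subseteq> E" "card K = matroid_rank \<I> E"
    by (rule indep_extends_to_rank[OF BI indep_subset_ground[OF BI]])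
  then have "K = B" using B by (simp add: bases_def)
  then show "B \<in> \<I> \<and> card B = matroid_rank \<I> E" using K BI by simp
next
  assume B: "B \<in> \<I> \<and> card B = matroid_rank \<I> E"
  have "J = B" if "J \<in> \<I>" "B \<subseteq> J" for J
    using card_seteq[OF finite_indep_set[OF that(1)] that(2)]
      card_le_rank[OF that(1) indep_subset_ground[OF that(1)]] B by simp
  then show "B \<in> bases \<I>" using B by (simp add: bases_def)
qed

text \<open>
  If the trace of \<open>B\<close> on \<open>F\<close> does not span \<open>F\<close>, some \<open>x \<in> F\<close> keeps the trace independent.
  Extending the enlarged trace inside \<open>insert x B\<close> loses exactly one element, which lies
  outside \<open>F\<close>.
\<close>

lemma base_exchange_into:
  assumes B: "B \<in> bases \<I>" and F: "F \<subseteq> E" and less: "card (B \<inter> F) < matroid_rank \<I> F"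
  obtains x y where "x \<in> F - B" "y \<in> B - F" "insert x (B - {y}) \<in> bases \<I>"
proof -
  have BI: "B \<in> \<I>" "card B = matroid_rank \<I> E" using B base_iff_card_eq_rank by auto
  have "B \<inter> F \<in> \<I>" using indep_hereditary[OF BI(1)] by simp
  then obtain K where K: "K \<in> \<I>" "B \<inter> F \<subseteq> K" "K \<subseteq> F" "card K = matroid_rank \<I> F"
    using indep_extends_to_rank[of "B \<inter> F" F] by auto
  have "K \<noteq> B \<inter> F" using K(4) less by auto
  then obtain x where x: "x \<in> K" "x \<notin> B" using K by blast
  have "insert x (B \<inter> F) \<in> \<I>" using indep_hereditary[OF K(1)] K x by auto
  then obtain C where C: "C \<in> \<I>" "insert x (B \<inter> F) \<subseteq> C" "C \<subseteq> insert x B"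
      "card C = matroid_rank \<I> (insert x B)"
    using indep_extends_to_rank[of "insert x (B \<inter> F)" "insert x B"] by auto
  have "card B \<le> card C" unfolding C(4) by (rule card_le_rank[OF BI(1)]) auto
  moreover have "card C \<le> matroid_rank \<I> E" by (rule card_le_rank[OF C(1) indep_subset_ground[OF C(1)]])
  ultimately have cC: "card C = card B" using BI(2) by simp
  then have Cbase: "C \<in> bases \<I>" using C(1) BI(2) base_iff_card_eq_rank by simp
  have finB: "finite B" using finite_indep_set[OF BI(1)] .
  have "\<not> B \<subseteq> C"
  proof
    assume "B \<subseteq> C"
    then have "C = insert x B" using C by auto
    then show False using cC finB x(2) by simp
  qed
  then obtain y where y: "y \<in> B" "y \<notin> C" by blast
  have "C \<subseteq> insert x (B - {y})" using C(3) y by auto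
  moreover have "card (insert x (B - {y})) = card C"
    using finB x y cC by (metis DiffD1 card.remove card_insert_disjoint finite_Diff)
  ultimately have "C = insert x (B - {y})" using finB by (intro card_subset_eq) auto
  moreover have "y \<notin> F" using y C(2) by auto
  ultimately show ?thesis using that[of x y] x y K Cbase by auto
qed

lemma minimum_weight_base_spans:
  fixes \<rho> :: "'a \<Rightarrow> real"
  assumes B: "B \<in> bases \<I>"
    and min: "\<And>C. C \<in> bases \<I> \<Longrightarrow> (\<Sum>e\<in>B. \<rho> e) \<le> (\<Sum>e\<in>C. \<rho> e)"
    and F: "F \<subseteq> E" and cheaper: "\<And>x y. x \<in> F \<Longrightarrow> y \<in> E - F \<Longrightarrow> \<rho> x < \<rho> y"
  shows "card (B \<inter> F) = matroid_rank \<I> F"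
proof (rule ccontr)
  have BI: "B \<in> \<I>" using B by (simp add: bases_def)
  have "card (B \<inter> F) \<le> matroid_rank \<I> F"
    using indep_hereditary[OF BI] by (intro card_le_rank) auto
  moreover assume "card (B \<inter> F) \<noteq> matroid_rank \<I> F"
  ultimately have "card (B \<inter> F) < matroid_rank \<I> F" by simp
  then obtain x y where xy: "x \<in> F - B" "y \<in> B - F" "insert x (B - {y}) \<in> bases \<I>"
    by (rule base_exchange_into[OF B F])
  have "(\<Sum>e\<in>insert x (B - {y}). \<rho> e) = \<rho> x + ((\<Sum>e\<in>B. \<rho> e) - \<rho> y)"
    using xy finite_indep_set[OF BI] by (simp add: sum_diff1)
  moreover have "\<rho> x < \<rho> y" using xy cheaper indep_subset_ground[OF BI] by auto
  ultimately show False using min[OF xy(3)] by simp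
qed


section \<open>Linear functionals on the base polytope\<close>

text \<open>
  The point \<open>\<eta>\<close> is an average of bases with weights \<open>l\<close>, so every weighted sum over a part \<open>X\<close> of the
  ground set is the average of the corresponding sums over \<open>B \<inter> X\<close>. This form serves both the
  rank inequalities, where \<open>w = 1\<close>, and the linear functional given by a weight.
\<close>

lemma base_polytope_decomposition:
  assumes "\<eta> \<in> base_polytope \<I>"
  obtains l :: "'a set \<Rightarrow> real" where "\<forall>B\<in>bases \<I>. l B \<ge> 0" "(\<Sum>B\<in>bases \<I>. l B) = 1"
    "\<forall>w. \<forall>X\<subseteq>E. (\<Sum>e\<in>X. w e * \<eta> e) = (\<Sum>B\<in>bases \<I>. l B * (\<Sum>e\<in>B \<inter> X. w e))"
proof -
  define S where "S = (\<lambda>B. indicator B :: 'a \<Rightarrow> real) ` bases \<I>"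
  have "finite S" using finite_bases by (simp add: S_def)
  then obtain u where u: "\<forall>v\<in>S. 0 \<le> u v" "sum u S = 1" "(\<Sum>v\<in>S. u v *\<^sub>R v) = \<eta>"
    using assms unfolding base_polytope_def S_def[symmetric] by (auto simp: convex_hull_finite)
  define l where "l B = u (indicator B)" for B :: "'a set"
  have inj: "inj_on (\<lambda>B. indicator B :: 'a \<Rightarrow> real) (bases \<I>)"
  proof (intro inj_onI set_eqI)
    fix A B :: "'a set" and x
    assume "(indicator A :: 'a \<Rightarrow> real) = indicator B"
    then have "(indicator A x :: real) = indicator B x" by simp
    then show "x \<in> A \<longleftrightarrow> x \<in> B" by (simp only: indicator_def of_bool_eq_iff)
  qed
  have \<eta>: "\<eta> e = (\<Sum>B\<in>bases \<I>. l B * indicator B e)" for e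
  proof -
    have "\<eta> e = (\<Sum>v\<in>S. u v * v e)" unfolding u(3)[symmetric] by (simp add: sum_fun_apply)
    then show ?thesis unfolding S_def l_def by (simp add: sum.reindex[OF inj])
  qed
  have "(\<Sum>e\<in>X. w e * \<eta> e) = (\<Sum>B\<in>bases \<I>. l B * (\<Sum>e\<in>B \<inter> X. w e))" if "X \<subseteq> E" for w X
  proof -
    have finX: "finite X" using that finite_ground finite_subset by blast
    have "(\<Sum>e\<in>X. w e * \<eta> e) = (\<Sum>e\<in>X. \<Sum>B\<in>bases \<I>. l B * (w e * indicator B e))"
      by (simp add: \<eta> sum_distrib_left mult_ac)
    also have "\<dots> = (\<Sum>B\<in>bases \<I>. l B * (\<Sum>e\<in>X. w e * indicator B e))"
      by (subst sum.swap) (simp add: sum_distrib_left)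
    also have "\<dots> = (\<Sum>B\<in>bases \<I>. l B * (\<Sum>e\<in>B \<inter> X. w e))"
      using finX by (simp add: sum_mult_indicator Int_commute Int_def conj_commute)
    finally show ?thesis .
  qed
  moreover have "(\<Sum>B\<in>bases \<I>. l B) = 1"
    using u(2) by (simp add: S_def l_def sum.reindex[OF inj])
  moreover have "l B \<ge> 0" if "B \<in> bases \<I>" for B using that u(1) by (simp add: S_def l_def)
  ultimately show ?thesis using that[of l] by blast
qed

lemma base_polytope_sum_le_rank:
  assumes "\<eta> \<in> base_polytope \<I>" "X \<subseteq> E"
  shows "(\<Sum>e\<in>X. \<eta> e) \<le> real (matroid_rank \<I> X)"
proof -
  obtain l where l: "\<forall>B\<in>bases \<I>. l B \<ge> 0" "(\<Sum>B\<in>bases \<I>. l B) = 1"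
    and eq: "\<forall>w. \<forall>X\<subseteq>E. (\<Sum>e\<in>X. w e * \<eta> e) = (\<Sum>B\<in>bases \<I>. l B * (\<Sum>e\<in>B \<inter> X. w e))"
    by (rule base_polytope_decomposition[OF assms(1)])
  have "(\<Sum>e\<in>X. \<eta> e) = (\<Sum>B\<in>bases \<I>. l B * real (card (B \<inter> X)))"
    using eq[rule_format, OF assms(2), of "\<lambda>_. 1"] by simp
  also have "\<dots> \<le> (\<Sum>B\<in>bases \<I>. l B * real (matroid_rank \<I> X))"
    using l(1) indep_hereditary
    by (intro sum_mono mult_left_mono of_nat_mono card_le_rank) (auto simp: bases_def)
  also have "\<dots> = real (matroid_rank \<I> X)" using l(2) by (simp flip: sum_distrib_right)
  finally show ?thesis .
qed

lemma base_polytope_sum_ground: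
  assumes "\<eta> \<in> base_polytope \<I>"
  shows "(\<Sum>e\<in>E. \<eta> e) = real (matroid_rank \<I> E)"
proof -
  obtain l where "\<forall>B\<in>bases \<I>. l B \<ge> 0" and l: "(\<Sum>B\<in>bases \<I>. l B) = 1"
    and eq: "\<forall>w. \<forall>X\<subseteq>E. (\<Sum>e\<in>X. w e * \<eta> e) = (\<Sum>B\<in>bases \<I>. l B * (\<Sum>e\<in>B \<inter> X. w e))"
    by (rule base_polytope_decomposition[OF assms])
  have "(\<Sum>e\<in>E. \<eta> e) = (\<Sum>B\<in>bases \<I>. l B * real (card (B \<inter> E)))"
    using eq[rule_format, of E "\<lambda>_. 1"] by simp
  also have "\<dots> = (\<Sum>B\<in>bases \<I>. l B * real (matroid_rank \<I> E))"
    using indep_subset_ground base_iff_card_eq_rank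
    by (intro sum.cong refl) (simp add: Int_absorb2)
  also have "\<dots> = real (matroid_rank \<I> E)" using l by (simp flip: sum_distrib_right)
  finally show ?thesis .
qed

text \<open>
  Minimizers of a linear functional form a face of the polytope: only bases that minimize the
  functional can occur in a convex combination that does, so \<open>\<eta>\<close> inherits the tight rank
  inequality from them.
\<close>

lemma minimum_weight_point_tight:
  assumes \<eta>: "\<eta> \<in> base_polytope \<I>"
    and min: "\<And>C. C \<in> bases \<I> \<Longrightarrow> (\<Sum>e\<in>E. \<rho> e * \<eta> e) \<le> (\<Sum>e\<in>C. \<rho> e)"
    and F: "F \<subseteq> E" and cheaper: "\<And>x y. x \<in> F \<Longrightarrow> y \<in> E - F \<Longrightarrow> \<rho> x < \<rho> y"
  shows "(\<Sum>e\<in>F. \<eta> e) = real (matroid_rank \<I> F)"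
proof -
  obtain l where l: "\<forall>B\<in>bases \<I>. l B \<ge> 0" "(\<Sum>B\<in>bases \<I>. l B) = 1"
    and eq: "\<forall>w. \<forall>X\<subseteq>E. (\<Sum>e\<in>X. w e * \<eta> e) = (\<Sum>B\<in>bases \<I>. l B * (\<Sum>e\<in>B \<inter> X. w e))"
    by (rule base_polytope_decomposition[OF \<eta>])
  define c where "c = (\<Sum>e\<in>E. \<rho> e * \<eta> e)"
  have "c = (\<Sum>B\<in>bases \<I>. l B * (\<Sum>e\<in>B. \<rho> e))"
    unfolding c_def eq[rule_format, OF subset_refl] using indep_subset_ground
    by (intro sum.cong refl) (auto simp: bases_def Int_absorb2)
  moreover have "c = (\<Sum>B\<in>bases \<I>. l B * c)" using l(2) by (simp flip: sum_distrib_right)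
  ultimately have "(\<Sum>B\<in>bases \<I>. l B * ((\<Sum>e\<in>B. \<rho> e) - c)) = 0"
    by (simp add: right_diff_distrib sum_subtractf)
  then have zero: "\<forall>B\<in>bases \<I>. l B * ((\<Sum>e\<in>B. \<rho> e) - c) = 0"
    using l(1) min by (subst (asm) sum_nonneg_eq_0_iff[OF finite_bases]) (auto simp: c_def)
  have "l B * real (card (B \<inter> F)) = l B * real (matroid_rank \<I> F)" if "B \<in> bases \<I>" for B
  proof (cases "l B = 0")
    case False
    then have "(\<Sum>e\<in>B. \<rho> e) = c" using zero that by auto
    then have "card (B \<inter> F) = matroid_rank \<I> F"
      using min by (intro minimum_weight_base_spans[where \<rho> = \<rho>, OF that _ F cheaper]) (auto simp: c_def)
    then show ?thesis by simp
  qed simp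
  then have "(\<Sum>B\<in>bases \<I>. l B * real (card (B \<inter> F)))
      = (\<Sum>B\<in>bases \<I>. l B * real (matroid_rank \<I> F))"
    by (intro sum.cong refl)
  then have "(\<Sum>e\<in>F. \<eta> e) = (\<Sum>B\<in>bases \<I>. l B * real (matroid_rank \<I> F))"
    using eq[rule_format, OF F, of "\<lambda>_. 1"] by simp
  also have "\<dots> = real (matroid_rank \<I> F)" using l(2) by (simp flip: sum_distrib_right)
  finally show ?thesis .
qed


section \<open>The universal density and its maximal level set\<close>

text \<open>
  Moving from \<open>\<eta>\<close> by a step \<open>t\<close> towards \<open>\<theta>\<close> changes the energy by \<open>2 t D + t\<^sup>2 Q\<close> with \<open>Q \<ge> 0\<close>,
  where \<open>D\<close> is the pairing of \<open>\<eta> / \<sigma>\<close> with \<open>\<theta> - \<eta>\<close>. If \<open>D\<close> were negative, a small step would lower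
  the energy.
\<close>

lemma energy_minimizer_first_order:
  assumes \<sigma>: "\<And>e. e \<in> E \<Longrightarrow> \<sigma> e > 0"
    and \<eta>: "is_arg_min (density_energy E \<sigma>) (\<lambda>\<eta>. \<eta> \<in> base_polytope \<I>) \<eta>"
    and \<theta>: "\<theta> \<in> base_polytope \<I>"
  shows "(\<Sum>e\<in>E. inverse (\<sigma> e) * \<eta> e * \<eta> e) \<le> (\<Sum>e\<in>E. inverse (\<sigma> e) * \<eta> e * \<theta> e)"
proof (rule ccontr)
  define D where "D = (\<Sum>e\<in>E. inverse (\<sigma> e) * \<eta> e * (\<theta> e - \<eta> e))"
  define Q where "Q = (\<Sum>e\<in>E. inverse (\<sigma> e) * (\<theta> e - \<eta> e)\<^sup>2)"
  assume "\<not> ?thesis"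
  then have D: "D < 0" by (simp add: D_def right_diff_distrib sum_subtractf)
  have Q: "Q \<ge> 0" unfolding Q_def using \<sigma> by (intro sum_nonneg mult_nonneg_nonneg) (auto simp: less_imp_le)
  \<comment> \<open>the second bound on the step makes \<open>t\<^sup>2 Q\<close> at most half of the linear gain \<open>- 2 t D\<close>\<close>
  define t where "t = min 1 (- D / (Q + 1))"
  have t: "0 < t" "t \<le> 1" using D Q by (auto simp: t_def divide_neg_pos)
  have "t * Q \<le> (- D / (Q + 1)) * Q" using Q by (intro mult_right_mono) (auto simp: t_def)
  also have "\<dots> \<le> - D" using D Q by (simp add: divide_simps mult_left_mono)
  finally have tQ: "t * Q \<le> - D" .
  define \<mu> where "\<mu> = (1 - t) *\<^sub>R \<eta> + t *\<^sub>R \<theta>"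
  have "\<eta> \<in> base_polytope \<I>" using \<eta> by (simp add: is_arg_min_def)
  then have "\<mu> \<in> base_polytope \<I>"
    unfolding \<mu>_def using \<theta> t unfolding base_polytope_def
    by (intro convexD[OF convex_convex_hull]) auto
  then have le: "density_energy E \<sigma> \<eta> \<le> density_energy E \<sigma> \<mu>"
    using \<eta> by (auto simp: is_arg_min_def not_less)
  have "inverse (\<sigma> e) * (\<mu> e)\<^sup>2 = inverse (\<sigma> e) * (\<eta> e)\<^sup>2
      + 2 * t * (inverse (\<sigma> e) * \<eta> e * (\<theta> e - \<eta> e)) + t\<^sup>2 * (inverse (\<sigma> e) * (\<theta> e - \<eta> e)\<^sup>2)" for e
    unfolding \<mu>_def plus_fun_apply scaleR_fun_apply real_scaleR_def
    by (simp add: power2_eq_square algebra_simps)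
  then have "density_energy E \<sigma> \<mu> = density_energy E \<sigma> \<eta> + 2 * t * D + t\<^sup>2 * Q"
    unfolding density_energy_def D_def Q_def sum_distrib_left sum.distrib[symmetric]
    by (intro sum.cong refl)
  with le have "0 \<le> t * (2 * D + t * Q)" by (simp add: power2_eq_square algebra_simps)
  then have "0 \<le> 2 * D + t * Q" using t by (simp add: zero_le_mult_iff)
  then show False using tQ D by simp
qed

text \<open>
  By the first-order condition \<open>\<eta>\<close> minimizes the linear functional with weight \<open>\<eta> / \<sigma>\<close>, and
  this weight is strictly smaller outside the maximal level set than on it.
\<close>

lemma universal_density_tight:
  assumes \<sigma>: "\<And>e. e \<in> E \<Longrightarrow> \<sigma> e > 0"
  shows "(\<Sum>e\<in>E - E_max E \<I> \<sigma>. universal_density E \<I> \<sigma> e)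
    = real (matroid_rank \<I> (E - E_max E \<I> \<sigma>))"
proof -
  define \<eta> where "\<eta> = universal_density E \<I> \<sigma>"
  have \<eta>: "is_arg_min (density_energy E \<sigma>) (\<lambda>\<eta>. \<eta> \<in> base_polytope \<I>) \<eta>"
    unfolding \<eta>_def by (rule universal_density_is_arg_min[OF \<sigma>])
  show ?thesis unfolding \<eta>_def[symmetric]
  proof (rule minimum_weight_point_tight[where \<rho> = "\<lambda>e. inverse (\<sigma> e) * \<eta> e"])
    show "\<eta> \<in> base_polytope \<I>" using \<eta> by (simp add: is_arg_min_def)
  next
    fix C assume C: "C \<in> bases \<I>"
    then have C_mem: "indicator C \<in> base_polytope \<I>"
      unfolding base_polytope_def by (intro hull_inc) auto
    have "(\<Sum>e\<in>E. inverse (\<sigma> e) * \<eta> e * \<eta> e)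
        \<le> (\<Sum>e\<in>E. inverse (\<sigma> e) * \<eta> e * indicator C e)"
      using \<sigma> \<eta> C_mem by (rule energy_minimizer_first_order)
    also have "\<dots> = (\<Sum>e\<in>C. inverse (\<sigma> e) * \<eta> e)"
      using C indep_subset_ground[of C] finite_ground
      by (simp add: bases_def sum_mult_indicator Int_absorb1 flip: Int_def)
    finally show "(\<Sum>e\<in>E. inverse (\<sigma> e) * \<eta> e * \<eta> e) \<le> (\<Sum>e\<in>C. inverse (\<sigma> e) * \<eta> e)" .
  next
    fix x y assume "x \<in> E - E_max E \<I> \<sigma>" "y \<in> E - (E - E_max E \<I> \<sigma>)"
    then show "inverse (\<sigma> x) * \<eta> x < inverse (\<sigma> y) * \<eta> y"
      unfolding E_max_def \<eta>_def[symmetric] by force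
  qed auto
qed

lemma universal_density_max_pos:
  assumes \<sigma>: "\<And>e. e \<in> E \<Longrightarrow> \<sigma> e > 0" and rank: "matroid_rank \<I> E > 0"
    and e: "e \<in> E_max E \<I> \<sigma>"
  shows "0 < inverse (\<sigma> e) * universal_density E \<I> \<sigma> e"
proof (rule ccontr)
  define \<eta> where "\<eta> = universal_density E \<I> \<sigma>"
  assume "\<not> ?thesis"
  then have "inverse (\<sigma> f) * \<eta> f \<le> 0" if "f \<in> E" for f
    using e that unfolding E_max_def \<eta>_def by fastforce
  then have "\<eta> f \<le> 0" if "f \<in> E" for f
    using \<sigma>[OF that] that by (fastforce simp: mult_le_0_iff)
  then have "(\<Sum>f\<in>E. \<eta> f) \<le> 0" by (rule sum_nonpos)
  moreover have "\<eta> \<in> base_polytope \<I>"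
    using universal_density_is_arg_min[OF \<sigma>] by (simp add: is_arg_min_def \<eta>_def)
  ultimately show False using rank by (simp add: base_polytope_sum_ground)
qed


section \<open>Bounds on the strength\<close>

lemma finite_strength_quotients:
  "finite {(\<Sum>e\<in>X. \<sigma> e) / (real (matroid_rank \<I> E) - real (matroid_rank \<I> (E - X))) | X.
            X \<subseteq> E \<and> matroid_rank \<I> E > matroid_rank \<I> (E - X)}"
  using finite_ground by simp

lemma strength_le:
  assumes "X \<subseteq> E" "0 < m" "0 < (\<Sum>e\<in>X. \<sigma> e)"
    and le: "m * (\<Sum>e\<in>X. \<sigma> e) \<le> real (matroid_rank \<I> E) - real (matroid_rank \<I> (E - X))"
  shows "strength E \<I> \<sigma> \<le> 1 / m"
proof -
  define d where "d = real (matroid_rank \<I> E) - real (matroid_rank \<I> (E - X))"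
  have "0 < m * (\<Sum>e\<in>X. \<sigma> e)" using assms by simp
  then have d: "0 < d" using le by (simp add: d_def)
  then have "strength E \<I> \<sigma> \<le> (\<Sum>e\<in>X. \<sigma> e) / d"
    unfolding strength_def d_def using assms(1)
    by (intro Min_le[OF finite_strength_quotients]) auto
  also have "\<dots> \<le> 1 / m" using le d assms(2) by (simp add: d_def field_simps)
  finally show ?thesis .
qed

text \<open>
  A point of the base polytope gives \<open>X\<close> at least the mass \<open>r(E) - r(E - X)\<close>, as it has total mass
  \<open>r(E)\<close> and leaves at most \<open>r(E - X)\<close> for the complement.
\<close>

lemma strength_ge:
  assumes \<eta>: "\<eta> \<in> base_polytope \<I>" and rank: "matroid_rank \<I> E > 0" and m: "0 < m"
    and le: "\<And>e. e \<in> E \<Longrightarrow> \<eta> e \<le> m * \<sigma> e"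
  shows "1 / m \<le> strength E \<I> \<sigma>"
proof -
  have bound: "1 / m \<le> (\<Sum>e\<in>X. \<sigma> e) / (real (matroid_rank \<I> E) - real (matroid_rank \<I> (E - X)))"
    if X: "X \<subseteq> E" "matroid_rank \<I> E > matroid_rank \<I> (E - X)" for X
  proof -
    have "real (matroid_rank \<I> E) = (\<Sum>e\<in>X. \<eta> e) + (\<Sum>e\<in>E - X. \<eta> e)"
      using base_polytope_sum_ground[OF \<eta>] sum.subset_diff[OF X(1) finite_ground, of \<eta>] by simp
    also have "\<dots> \<le> (\<Sum>e\<in>X. m * \<sigma> e) + real (matroid_rank \<I> (E - X))"
      using X(1) le by (intro add_mono sum_mono base_polytope_sum_le_rank[OF \<eta>]) auto
    finally have "real (matroid_rank \<I> E) - real (matroid_rank \<I> (E - X)) \<le> m * (\<Sum>e\<in>X. \<sigma> e)"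
      by (simp add: sum_distrib_left)
    then show ?thesis using X(2) m by (simp add: field_simps)
  qed
  have "matroid_rank \<I> {} = 0"
    using rank_attained[of "{}"] by (metis card.empty subset_empty)
  then have "matroid_rank \<I> (E - E) < matroid_rank \<I> E" using rank by simp
  then have "{(\<Sum>e\<in>X. \<sigma> e) / (real (matroid_rank \<I> E) - real (matroid_rank \<I> (E - X))) | X.
            X \<subseteq> E \<and> matroid_rank \<I> E > matroid_rank \<I> (E - X)} \<noteq> {}" by blast
  then show ?thesis unfolding strength_def
    using bound by (intro Min.boundedI[OF finite_strength_quotients]) auto
qed

end

lemma matroid_rank_restrict:
  assumes "X \<subseteq> H"
  shows "matroid_rank (restrict_indep \<I> H) X = matroid_rank \<I> X"
proof -
  have "(J \<in> restrict_indep \<I> H \<and> J \<subseteq> X) = (J \<in> \<I> \<and> J \<subseteq> X)" for J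
    using assms by (auto simp: restrict_indep_def)
  then show ?thesis by (simp add: matroid_rank_def)
qed

theorem proposition6p6:
  fixes E H :: "'a set" and \<I> :: "'a set set" and \<sigma> :: "'a \<Rightarrow> real"
  assumes "matroid E \<I>"
    and "loopless E \<I>"
    and "matroid_rank \<I> E > 0"
    and "\<And>e. e \<in> E \<Longrightarrow> \<sigma> e > 0"
    and "H \<subseteq> E"
    and "H \<inter> E_max E \<I> \<sigma> \<noteq> {}"
  shows "strength H (restrict_indep \<I> H) \<sigma> \<le> strength E \<I> \<sigma>"
proof -
  interpret matroid E \<I> by fact
  interpret restriction: matroid H "restrict_indep \<I> H"
    by (rule matroid_restrict) fact+
  define \<eta> where "\<eta> = universal_density E \<I> \<sigma>"
  define F where "F = E - E_max E \<I> \<sigma>"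
  define X where "X = H \<inter> E_max E \<I> \<sigma>"
  obtain a where a: "a \<in> X" using assms(6) by (auto simp: X_def)
  define m where "m = inverse (\<sigma> a) * \<eta> a"
  have \<eta>: "\<eta> \<in> base_polytope \<I>"
    using universal_density_is_arg_min[of \<sigma>] assms(4) by (simp add: is_arg_min_def \<eta>_def)
  have m: "0 < m"
    using universal_density_max_pos[of \<sigma> a] assms(3,4) a by (simp add: m_def \<eta>_def X_def)
  have level: "inverse (\<sigma> e) * \<eta> e = m" if "e \<in> X" for e
    using that a unfolding X_def m_def \<eta>_def E_max_def by (auto intro: antisym)
  have X_eq: "\<eta> e = m * \<sigma> e" if "e \<in> X" for e
    using level[OF that] assms(4)[of e] assms(5) that by (auto simp: X_def field_simps)
  have E_le: "\<eta> e \<le> m * \<sigma> e" if "e \<in> E" for e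
  proof -
    have "inverse (\<sigma> e) * \<eta> e \<le> m" using a that by (simp add: X_def m_def \<eta>_def E_max_def)
    then show ?thesis using assms(4)[OF that] by (simp add: field_simps)
  qed
  have sets: "H - X = H \<inter> F" "H \<union> F = X \<union> F" "X \<inter> F = {}" "H \<union> F \<subseteq> E"
    using assms(5) by (auto simp: X_def F_def)
  have fin: "finite X" "finite F"
    using sets(2,4) finite_subset[OF _ finite_ground] by auto
  have "m * (\<Sum>e\<in>X. \<sigma> e) = (\<Sum>e\<in>X. \<eta> e)" by (simp add: X_eq sum_distrib_left)
  also have "\<dots> = (\<Sum>e\<in>H \<union> F. \<eta> e) - (\<Sum>e\<in>F. \<eta> e)"
    unfolding sets(2) sum.union_disjoint[OF fin sets(3)] by simp
  also have "\<dots> \<le> real (matroid_rank \<I> (H \<union> F)) - real (matroid_rank \<I> F)"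
    using base_polytope_sum_le_rank[OF \<eta> sets(4)] universal_density_tight[of \<sigma>] assms(4)
    by (simp add: \<eta>_def F_def)
  also have "\<dots> \<le> real (matroid_rank \<I> H) - real (matroid_rank \<I> (H - X))"
    unfolding sets(1) using rank_submodular[of H F] by linarith
  finally have key:
    "m * (\<Sum>e\<in>X. \<sigma> e) \<le> real (matroid_rank \<I> H) - real (matroid_rank \<I> (H - X))" .
  have "strength H (restrict_indep \<I> H) \<sigma> \<le> 1 / m"
  proof (rule restriction.strength_le)
    show "X \<subseteq> H" by (simp add: X_def)
    show "0 < (\<Sum>e\<in>X. \<sigma> e)"
      using a fin assms(4,5) by (intro sum_pos) (auto simp: X_def)
  qed (use m key in \<open>simp_all add: matroid_rank_restrict\<close>)
  also have "1 / m \<le> strength E \<I> \<sigma>" by (rule strength_ge[OF \<eta> assms(3) m E_le])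
  finally show ?thesis .
qed

end
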